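(* In the setting described in the context, suppose that Assumptions A0, A1 and A2 stated there hold. Further assume that $u_i^h\overset{\mathcal{H}}{\rightarrow}u_i$ for $i=0,1$, with $u_1\ne u_0$ and $u_1^h\ne u_0^h$. Then for each $\epsilon>0$ there exists $h_\epsilon>0$ such that $$k^*(\epsilon)-\ell\le k_h^*(\epsilon)\le k^*(\epsilon)\quad\text{for every }h\in(0,h_\epsilon],$$ where the integer $\ell>0$ is independent of $h$ and $\epsilon$.
   Context: Continuous problem and algorithm. $\mathcal{H}$ is a Hilbert space with inner product $(\cdot,\cdot)$ and norm $\|\cdot\|$, $\mathcal{F}:\mathcal{H}\to\mathbb{R}$ is twice continuously Fréchet differentiable with gradient (Riesz representative of $\mathcal{F}'$) $\mathcal{G}:\mathcal{H}\to\mathcal{H}$, and $\mathcal{G}_k:=\mathcal{G}(u_k)$. The Barzilai-Borwein (BB) gradient algorithm with initial iterates $u_0\ne u_1$ proceeds for $k=1,2,\dots$ as follows: if $\|\mathcal{G}_k\|=0$ stop; otherwise set $u_{k+1}=u_k-\frac1{\alpha_k}\mathcal{G}_k$, where $\alpha_k$ is chosen equal to either $\alpha_k^{BB1}=\frac{(\mathcal{S}_{k-1},\mathcal{Y}_{k-1})}{(\mathcal{S}_{k-1},\mathcal{S}_{k-1})}$ or $\alpha_k^{BB2}=\frac{(\mathcal{Y}_{k-1},\mathcal{Y}_{k-1})}{(\mathcal{S}_{k-1},\mathcal{Y}_{k-1})}$, with $\mathcal{S}_{k-1}=u_k-u_{k-1}$, $\mathcal{Y}_{k-1}=\mathcal{G}_k-\mathcal{G}_{k-1}$.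 Assumption A0: $u^*$ is a local minimizer of $\mathcal{F}$, $\mathcal{F}''$ is locally Lipschitz continuous, and $\delta_{\inf}\|v\|^2\le\mathcal{F}''(u^* )(v,v)\le\delta_{\sup}\|v\|^2$ for all $v\in\mathcal{H}$ with constants $\delta_{\sup}\ge\delta_{\inf}>0$. Under these hypotheses there are positive constants $\zeta,\lambda_1,\lambda_2$ and $\theta<1$ such that for all initial iterates $u_0\neq u_1$ in the ball $\mathcal{B}_\zeta(u^* )$ of radius $\zeta$ centered at $u^*$ the generated sequence satisfies $\|u_k-u^*\|\le\lambda_1\theta^k\|u_1-u^*\|$ and $\|\mathcal{G}_k\|\le\lambda_2\theta^k\|\mathcal{G}_1\|$ for all $k\ge1$. $\{u_k\}_k$ denotes the sequence generated by the algorithm which enjoys these properties; in particular it is assumed that $\|u_0-u^*\|$ and $\|u_1-u^*\|$ are sufficiently small ($<\zeta$), unless $\mathcal{F}$ is a strictly convex quadratic function $\mathcal{F}(u)=\frac12(\mathcal{A}u,u)-(b,u)$ ($b\in\mathcal{H}$, $\mathcal{A}$ bounded, self-adjoint, uniformly positive), in which case $u_0,u_1$ can be chosen from the whole of $\mathcal{H}$. Discrete problems. $\{\mathcal{H}^h\}_h$ is a family of finite-dimensional Hilbert spaces indexed by real $h>0$, with inner products $(\cdot,\cdot)_h$ and norms $\|\cdot\|_h$; $\mathcal{G}^h:\mathcal{H}^h\to\mathcal{H}^h$ are continuous nonlinear mappings; $\mathbb{P}^h:\mathcal{H}^h\to\mathcal{H}$ are linear prolongation operators. One writes $u^h\overset{\mathcal{H}}{\rightarrow}u$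 (for $u^h\in\mathcal{H}^h$, $u\in\mathcal{H}$) if $\lim_{h\downarrow0}\|\mathbb{P}^hu^h-u\|=0$. Given $u_0^h,u_1^h\in\mathcal{H}^h$, the discrete sequence is $u_{k+1}^h=u_k^h-\frac1{\alpha_k^h}\mathcal{G}_k^h$, $k\ge1$, $\mathcal{G}_k^h:=\mathcal{G}^h(u_k^h)$, with $\alpha_k^h$ chosen according to either $\alpha_k^{BB1,h}=\frac{(\mathcal{S}_{k-1}^h,\mathcal{Y}_{k-1}^h)_h}{(\mathcal{S}_{k-1}^h,\mathcal{S}_{k-1}^h)_h}$ or $\alpha_k^{BB2,h}=\frac{(\mathcal{Y}_{k-1}^h,\mathcal{Y}_{k-1}^h)_h}{(\mathcal{S}_{k-1}^h,\mathcal{Y}_{k-1}^h)_h}$, where $\mathcal{S}_{k-1}^h=u_k^h-u_{k-1}^h$, $\mathcal{Y}_{k-1}^h=\mathcal{G}_k^h-\mathcal{G}_{k-1}^h$. Assumption A1: if $u^h\overset{\mathcal{H}}{\rightarrow}u$ and $z^h\overset{\mathcal{H}}{\rightarrow}z$ for $u,z\in\mathcal{H}$, then $\lim_{h\downarrow0}(u^h,z^h)_h=(u,z)$. Assumption A2: $\mathcal{G}(u^* )=0$, and if $u^h\overset{\mathcal{H}}{\rightarrow}u$ with $u$ in a neighborhood of $u^*$, then $\mathcal{G}^h(u^h)\overset{\mathcal{H}}{\rightarrow}\mathcal{G}(u)$. Iteration counts (with $\mathbb{N}=\{1,2,\dots\}$): $k^*(\epsilon):=\min\{k\in\mathbb{N}:\|\mathcal{G}_k\|<\epsilon\}$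 and $k_h^*(\epsilon):=\min\{k\in\mathbb{N}:\|\mathcal{G}_k^h\|_h<\epsilon\}$.
   Formalization: The neighborhood of u* in Assumption A2 is additionally required to contain all iterates u_k (otherwise the claim can fail, e.g. for quadratic F with distant initial iterates), and the discrete runs use the same BB1/BB2 choice at each step k as the continuous run. *)

theory Defs
  imports "HOL-Analysis.Analysis"
begin

text \<open>The iteration is stated for an arbitrary inner product \<open>ip\<close>, so that it covers both the
  Hilbert space (\<open>ip = (\<bullet>)\<close>) and the discrete spaces, whose inner products vary with \<open>h\<close>.\<close>

datatype bb_rule = BB1 | BB2

definition bb_alpha ::
  "('v::real_vector \<Rightarrow> 'v \<Rightarrow> real) \<Rightarrow> ('v \<Rightarrow> 'v) \<Rightarrow> bb_rule \<Rightarrow> (nat \<Rightarrow> 'v) \<Rightarrow> nat \<Rightarrow> real" where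
  "bb_alpha ip G r u k =
     (let S = u k - u (k - 1); Y = G (u k) - G (u (k - 1))
      in case r of BB1 \<Rightarrow> ip S Y / ip S S | BB2 \<Rightarrow> ip Y Y / ip S Y)"

text \<open>\<open>r k\<close> is the formula used for the step size at iteration \<open>k\<close>. Once \<open>G (u k) = 0\<close> the equation
  gives \<open>u (k + 1) = u k\<close>: a run that stops is represented by the sequence staying at its last
  iterate.\<close>

definition bb_sequence ::
  "('v::real_vector \<Rightarrow> 'v \<Rightarrow> real) \<Rightarrow> ('v \<Rightarrow> 'v) \<Rightarrow> (nat \<Rightarrow> bb_rule) \<Rightarrow> (nat \<Rightarrow> 'v) \<Rightarrow> bool" where
  "bb_sequence ip G r u \<longleftrightarrow>
     (\<forall>k\<ge>1. u (Suc k) = u k - (1 / bb_alpha ip G (r k) u k) *\<^sub>R G (u k))"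

text \<open>\<open>LEAST\<close> is unspecified when no \<open>k\<close> qualifies; statements using this function have to assert
  existence separately.\<close>

definition iteration_count :: "(nat \<Rightarrow> real) \<Rightarrow> real \<Rightarrow> nat" where
  "iteration_count residual \<epsilon> = (LEAST k. 1 \<le> k \<and> residual k < \<epsilon>)"

definition locally_lipschitz :: "('a::metric_space \<Rightarrow> 'b::metric_space) \<Rightarrow> bool" where
  "locally_lipschitz f \<longleftrightarrow> (\<forall>x. \<exists>\<rho>>0. \<exists>L. L-lipschitz_on (ball x \<rho>) f)"

definition strictly_convex_quadratic :: "('a::real_inner \<Rightarrow> real) \<Rightarrow> bool" where
  "strictly_convex_quadratic F \<longleftrightarrow>
     (\<exists>(A :: 'a \<Rightarrow>\<^sub>L 'a) b. (\<forall>x y. blinfun_apply A x \<bullet> y = x \<bullet> blinfun_apply A y) \<and>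
        (\<exists>c>0. \<forall>x. c * (norm x)\<^sup>2 \<le> blinfun_apply A x \<bullet> x) \<and>
        (\<forall>x. F x = 1 / 2 * (blinfun_apply A x \<bullet> x) - b \<bullet> x))"

text \<open>A finite-dimensional Hilbert space whose dimension may depend on a parameter is a
  finite-dimensional subspace \<open>V\<close> of a real vector space type, with an inner product that is
  constrained on \<open>V\<close> only. A family of such spaces can always be placed in one type, e.g. in the
  direct sum of its members.\<close>

definition finite_dim_hilbert_on ::
  "'b::real_vector set \<Rightarrow> ('b \<Rightarrow> 'b \<Rightarrow> real) \<Rightarrow> bool" where
  "finite_dim_hilbert_on V ip \<longleftrightarrow>
     (\<exists>B. finite B \<and> V = span B) \<and>
     (\<forall>x\<in>V. \<forall>y\<in>V. ip x y = ip y x) \<and>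
     (\<forall>x\<in>V. \<forall>y\<in>V. \<forall>z\<in>V. ip (x + y) z = ip x z + ip y z) \<and>
     (\<forall>c. \<forall>x\<in>V. \<forall>y\<in>V. ip (c *\<^sub>R x) y = c * ip x y) \<and>
     (\<forall>x\<in>V. x \<noteq> 0 \<longrightarrow> 0 < ip x x)"

definition ip_norm :: "('b \<Rightarrow> 'b \<Rightarrow> real) \<Rightarrow> 'b \<Rightarrow> real" where
  "ip_norm ip x = sqrt (ip x x)"

definition linear_map_on :: "'b::real_vector set \<Rightarrow> ('b \<Rightarrow> 'a::real_vector) \<Rightarrow> bool" where
  "linear_map_on V f \<longleftrightarrow>
     (\<forall>x\<in>V. \<forall>y\<in>V. f (x + y) = f x + f y) \<and> (\<forall>c. \<forall>x\<in>V. f (c *\<^sub>R x) = c *\<^sub>R f x)"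

definition continuous_self_map_on ::
  "'b::real_vector set \<Rightarrow> ('b \<Rightarrow> 'b \<Rightarrow> real) \<Rightarrow> ('b \<Rightarrow> 'b) \<Rightarrow> bool" where
  "continuous_self_map_on V ip g \<longleftrightarrow>
     g \<in> V \<rightarrow> V \<and>
     continuous_map (Metric_space.mtopology V (\<lambda>x y. ip_norm ip (x - y)))
                    (Metric_space.mtopology V (\<lambda>x y. ip_norm ip (x - y))) g"

definition discrete_family :: "(real \<Rightarrow> 'b set) \<Rightarrow> (real \<Rightarrow> 'b) \<Rightarrow> bool" where
  "discrete_family V x \<longleftrightarrow> (\<forall>h>0. x h \<in> V h)"

definition H_converges ::
  "(real \<Rightarrow> 'b \<Rightarrow> 'a::real_normed_vector) \<Rightarrow> (real \<Rightarrow> 'b) \<Rightarrow> 'a \<Rightarrow> bool" where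
  "H_converges P x u \<longleftrightarrow> ((\<lambda>h. norm (P h (x h) - u)) \<longlongrightarrow> 0) (at_right 0)"

text \<open>R-linear convergence, with constants that do not depend on the initial iterates in \<open>D\<close> or on
  the choice of step sizes.\<close>

definition bb_r_linear_on ::
  "('a::real_inner \<Rightarrow> 'a) \<Rightarrow> 'a \<Rightarrow> 'a set \<Rightarrow> real \<Rightarrow> real \<Rightarrow> real \<Rightarrow> bool" where
  "bb_r_linear_on G ustar D lam1 lam2 \<theta> \<longleftrightarrow>
     (\<forall>r v. v 0 \<in> D \<and> v 1 \<in> D \<and> v 0 \<noteq> v 1 \<and> bb_sequence (\<bullet>) G r v \<longrightarrow>
        (\<forall>k\<ge>1. norm (v k - ustar) \<le> lam1 * \<theta> ^ k * norm (v 1 - ustar) \<and>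
               norm (G (v k)) \<le> lam2 * \<theta> ^ k * norm (G (v 1))))"

end

theory Submission
  imports Defs
begin

text \<open>
  The theorem combines two facts.

  \<^emph>\<open>Consistency of a fixed number of steps.\<close> A Barzilai-Borwein step is a continuous function of the
  inner products of the current differences, as long as \<open>S \<bullet> Y \<noteq> 0\<close>. Hence for a \<^emph>\<open>fixed\<close> index \<open>k\<close>
  the discrete iterate converges to \<open>u k\<close> as \<open>h\<close> tends to \<open>0\<close>, provided that \<open>S \<bullet> Y \<noteq> 0\<close> at all
  earlier steps of the continuous run (\<open>iterates_converge\<close>), and the discrete residuals then converge to
  \<open>norm (G (u k))\<close>. Degenerate steps at a nonzero gradient are excluded by R-linear convergence: with
  \<open>x / 0 = 0\<close>, a step with \<open>S \<bullet> Y = 0\<close> leaves the iterate unchanged, all later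
  differences vanish and the run stays there forever (\<open>bb_sequence_stalls\<close>); as its residuals tend
  to zero, the gradient was zero already (\<open>bb_curvature_nonzero\<close>).

  For a given \<open>\<epsilon>\<close> only the indices up to \<open>k\<^sup>*(\<epsilon>)\<close> matter. At \<open>k\<^sup>*(\<epsilon>)\<close> the residual is strictly
  below \<open>\<epsilon>\<close>, so the discrete one is as well for small \<open>h\<close>: this is the upper bound. At an index
  \<open>k < k\<^sup>*(\<epsilon>)\<close> the residual is at least \<open>\<epsilon>\<close>. If it is larger than \<open>\<epsilon>\<close>, then the discrete run
  cannot stop at \<open>k\<close> for small \<open>h\<close>. Only a tie \<open>norm (G (u k)) = \<epsilon>\<close> can make the discrete run stop
  earlier, and \<open>\<ell>\<close> accounts for it.

  \<^emph>\<open>Ties are resolved in boundedly many steps.\<close> The constants of R-linear convergence are the same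
  for all admissible starting pairs, so the estimate may be restarted at a late iterate \<open>u j\<close>. It
  shows that the residual falls strictly below \<open>norm (G (u j))\<close> after a number of steps that does not
  depend on \<open>j\<close>. The finitely many early iterates, which may lie outside of the ball of admissible
  initial values, only enlarge the constant (\<open>iteration_count_after_tie\<close>).
\<close>

section \<open>Iteration counts of vanishing residuals\<close>

lemma iteration_count_le:
  assumes "1 \<le> k" "g k < \<epsilon>"
  shows "iteration_count g \<epsilon> \<le> k"
  unfolding iteration_count_def using assms by (intro Least_le) simp

lemma iteration_count_attained:
  assumes "\<exists>k\<ge>1. g k < \<epsilon>"
  shows "1 \<le> iteration_count g \<epsilon>" "g (iteration_count g \<epsilon>) < \<epsilon>"
  using LeastI_ex[of "\<lambda>k. 1 \<le> k \<and> g k < \<epsilon>"] assms unfolding iteration_count_def by auto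

lemma not_below_before_iteration_count:
  assumes "1 \<le> k" "k < iteration_count g \<epsilon>"
  shows "\<epsilon> \<le> g k"
  using iteration_count_le[of k g \<epsilon>] assms by force

lemma small_residual_exists:
  fixes g :: "nat \<Rightarrow> real"
  assumes "g \<longlonglongrightarrow> 0" "\<epsilon> > 0"
  shows "\<exists>k\<ge>1. g k < \<epsilon>"
  using eventually_conj[OF order_tendstoD(2)[OF assms] eventually_ge_at_top[of 1]]
  by (auto simp: eventually_sequentially)

text \<open>A uniform decrease over \<open>M\<close> steps settles the indices \<open>j \<ge> K\<close>. For each of the remaining
  indices, a nonzero \<open>g j\<close> is a fixed threshold, which the sequence passes at some index \<open>p j\<close>
  that works for all \<open>\<epsilon> \<ge> g j\<close>; there are only finitely many of them.\<close>

lemma iteration_count_after_tie: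
  fixes g :: "nat \<Rightarrow> real"
  assumes lim: "g \<longlonglongrightarrow> 0" and nonneg: "\<And>k. 0 \<le> g k"
    and decrease: "\<And>j. K \<le> j \<Longrightarrow> g j \<noteq> 0 \<Longrightarrow> g (j + M) < g j"
  obtains l where "0 < l"
    "\<And>j \<epsilon>. 0 < \<epsilon> \<Longrightarrow> 1 \<le> j \<Longrightarrow> g j \<le> \<epsilon> \<Longrightarrow> iteration_count g \<epsilon> \<le> j + l"
proof -
  have "\<exists>m. g j \<noteq> 0 \<longrightarrow> 1 \<le> m \<and> g m < g j" for j
    using small_residual_exists[OF lim, of "g j"] nonneg[of j] by (cases "g j = 0") auto
  then obtain p where p: "\<And>j. g j \<noteq> 0 \<Longrightarrow> 1 \<le> p j \<and> g (p j) < g j"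
    by metis
  define l where "l = Suc (M + (\<Sum>j<K. p j))"
  have "iteration_count g \<epsilon> \<le> j + l" if "0 < \<epsilon>" "1 \<le> j" "g j \<le> \<epsilon>" for j \<epsilon>
  proof -
    consider "g j = 0" | "g j \<noteq> 0" "K \<le> j" | "g j \<noteq> 0" "j < K"
      by linarith
    then show ?thesis
    proof cases
      case 1
      then show ?thesis using iteration_count_le[of j g \<epsilon>] that by simp
    next
      case 2
      then show ?thesis
        using iteration_count_le[of "j + M" g \<epsilon>] decrease[of j] that by (simp add: l_def)
    next
      case 3
      have "iteration_count g \<epsilon> \<le> p j"
        using iteration_count_le[of "p j" g \<epsilon>] p[of j] 3 that by simp
      also have "p j \<le> (\<Sum>j<K. p j)"
        using 3 by (intro member_le_sum) auto
      finally show ?thesis by (simp add: l_def)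
    qed
  qed
  moreover have "0 < l" by (simp add: l_def)
  ultimately show thesis using that by blast
qed

section \<open>R-linearly convergent Barzilai-Borwein runs\<close>

lemma bb_sequence_shift:
  assumes "bb_sequence ip G r u"
  shows "bb_sequence ip G (\<lambda>i. r (i + n)) (\<lambda>i. u (i + n))"
  unfolding bb_sequence_def
proof (intro allI impI)
  fix k :: nat
  assume k: "1 \<le> k"
  then have "bb_alpha ip G (r (k + n)) (\<lambda>i. u (i + n)) k = bb_alpha ip G (r (k + n)) u (k + n)"
    by (simp add: bb_alpha_def)
  moreover have "u (Suc (k + n))
      = u (k + n) - (1 / bb_alpha ip G (r (k + n)) u (k + n)) *\<^sub>R G (u (k + n))"
    using assms k unfolding bb_sequence_def by simp
  ultimately show "u (Suc k + n)
      = u (k + n) - (1 / bb_alpha ip G (r (k + n)) (\<lambda>i. u (i + n)) k) *\<^sub>R G (u (k + n))"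
    by simp
qed

text \<open>If two consecutive iterates coincide, then both step sizes are quotients with numerator or
  denominator zero, hence zero by \<open>x / 0 = 0\<close>, and the next difference vanishes too.\<close>

lemma bb_sequence_stalls:
  assumes "bb_sequence (\<bullet>) G r u" and "u (Suc k) = u k"
  shows "u (k + m) = u k"
proof -
  have "u (Suc (k + m)) = u k \<and> u (k + m) = u k"
  proof (induction m)
    case 0
    then show ?case using assms(2) by simp
  next
    case (Suc m)
    then have "bb_alpha (\<bullet>) G (r (Suc (k + m))) u (Suc (k + m)) = 0"
      by (simp add: bb_alpha_def Let_def split: bb_rule.split)
    moreover have "u (Suc (Suc (k + m))) = u (Suc (k + m))
        - (1 / bb_alpha (\<bullet>) G (r (Suc (k + m))) u (Suc (k + m))) *\<^sub>R G (u (Suc (k + m)))"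
      using assms(1) unfolding bb_sequence_def by simp
    ultimately show ?case using Suc by simp
  qed
  then show ?thesis ..
qed

context
  fixes G :: "'a::real_inner \<Rightarrow> 'a" and ustar :: 'a and D :: "'a set"
    and lam1 lam2 \<theta> :: real and r :: "nat \<Rightarrow> bb_rule" and u :: "nat \<Rightarrow> 'a"
  assumes r_linear: "bb_r_linear_on G ustar D lam1 lam2 \<theta>"
    and \<theta>: "0 < \<theta>" "\<theta> < 1"
    and init: "u 0 \<in> D" "u 1 \<in> D" "u 1 \<noteq> u 0"
    and bb: "bb_sequence (\<bullet>) G r u"
begin

lemma bb_bounds:
  assumes "1 \<le> k"
  shows "norm (u k - ustar) \<le> lam1 * \<theta> ^ k * norm (u 1 - ustar)"
    "norm (G (u k)) \<le> lam2 * \<theta> ^ k * norm (G (u 1))"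
  using r_linear[unfolded bb_r_linear_on_def, rule_format, of u r k] init bb assms by auto

lemma bb_iterates_tendsto: "u \<longlonglongrightarrow> ustar"
proof (rule LIM_zero_cancel, rule Lim_null_comparison)
  show "\<forall>\<^sub>F k in sequentially. norm (u k - ustar) \<le> lam1 * \<theta> ^ k * norm (u 1 - ustar)"
    using eventually_ge_at_top[of 1] bb_bounds(1) by (rule eventually_mono)
  show "(\<lambda>k. lam1 * \<theta> ^ k * norm (u 1 - ustar)) \<longlonglongrightarrow> 0"
    using \<theta> by (intro tendsto_mult_left_zero tendsto_mult_right_zero LIMSEQ_realpow_zero) auto
qed

lemma bb_gradient_tendsto: "(\<lambda>k. norm (G (u k))) \<longlonglongrightarrow> 0"
proof (rule Lim_null_comparison)
  show "\<forall>\<^sub>F k in sequentially. norm (norm (G (u k))) \<le> lam2 * \<theta> ^ k * norm (G (u 1))"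
    using eventually_ge_at_top[of 1] by (rule eventually_mono) (use bb_bounds(2) in simp)
  show "(\<lambda>k. lam2 * \<theta> ^ k * norm (G (u 1))) \<longlonglongrightarrow> 0"
    using \<theta> by (intro tendsto_mult_left_zero tendsto_mult_right_zero LIMSEQ_realpow_zero) auto
qed

text \<open>The residuals tend to zero and are constant from the stall on.\<close>

lemma bb_stall_imp_gradient_zero:
  assumes "u (Suc k) = u k"
  shows "G (u k) = 0"
proof -
  have "(\<lambda>m. norm (G (u (m + k)))) \<longlonglongrightarrow> 0"
    using bb_gradient_tendsto by (rule LIMSEQ_ignore_initial_segment)
  moreover have "u (m + k) = u k" for m
    using bb_sequence_stalls[OF bb assms, of m] by (simp add: add.commute)
  ultimately show ?thesis by (simp add: LIMSEQ_const_iff)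
qed

text \<open>Were the curvature zero, either rule would give \<open>bb_alpha = 0\<close> and thus a stall at a point
  where the gradient does not vanish.\<close>

lemma bb_curvature_nonzero:
  assumes "1 \<le> k" "G (u k) \<noteq> 0"
  shows "(u k - u (k - 1)) \<bullet> (G (u k) - G (u (k - 1))) \<noteq> 0"
proof
  assume "(u k - u (k - 1)) \<bullet> (G (u k) - G (u (k - 1))) = 0"
  then have "bb_alpha (\<bullet>) G (r k) u k = 0"
    by (simp add: bb_alpha_def Let_def split: bb_rule.split)
  then have "u (Suc k) = u k"
    using bb assms(1) unfolding bb_sequence_def by simp
  then show False
    using bb_stall_imp_gradient_zero assms(2) by blast
qed

text \<open>The pair \<open>u (j - 1), u j\<close> is an admissible start when both iterates lie in \<open>D\<close>, and they
  are distinct unless the gradient vanishes. The restarted estimate has the same constants, so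
  \<open>lam2 * \<theta> ^ Suc M < 1\<close> is all that is required of \<open>M\<close>.\<close>

lemma bb_gradient_decrease:
  assumes "eventually (\<lambda>k. u k \<in> D) sequentially"
  obtains K M where "\<And>j. K \<le> j \<Longrightarrow> G (u j) \<noteq> 0 \<Longrightarrow> norm (G (u (j + M))) < norm (G (u j))"
proof -
  obtain K where K: "\<And>k. K \<le> k \<Longrightarrow> u k \<in> D"
    using assms unfolding eventually_sequentially by blast
  have "(\<lambda>m. lam2 * \<theta> ^ m) \<longlonglongrightarrow> 0"
    using \<theta> by (intro tendsto_mult_right_zero LIMSEQ_realpow_zero) auto
  then have "(\<lambda>m. lam2 * \<theta> ^ Suc m) \<longlonglongrightarrow> 0"
    by (rule LIMSEQ_Suc)
  then have "eventually (\<lambda>m. lam2 * \<theta> ^ Suc m < 1) sequentially"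
    by (rule order_tendstoD) simp
  then obtain M where M: "lam2 * \<theta> ^ Suc M < 1"
    unfolding eventually_sequentially by blast
  have "norm (G (u (j + M))) < norm (G (u j))" if "Suc K \<le> j" "G (u j) \<noteq> 0" for j
  proof -
    obtain n where j: "j = Suc n"
      using \<open>Suc K \<le> j\<close> by (cases j) auto
    have "u (Suc n) \<noteq> u n"
      using bb_stall_imp_gradient_zero[of n] that(2) j by auto
    moreover have "u n \<in> D" "u (Suc n) \<in> D"
      using K that(1) j by auto
    ultimately have "\<forall>k\<ge>1. norm (G (u (k + n))) \<le> lam2 * \<theta> ^ k * norm (G (u (1 + n)))"
      using r_linear[unfolded bb_r_linear_on_def, rule_format,
          of "\<lambda>i. u (i + n)" "\<lambda>i. r (i + n)"] bb_sequence_shift[OF bb, of n]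
      by simp
    then have "norm (G (u (Suc M + n))) \<le> lam2 * \<theta> ^ Suc M * norm (G (u j))"
      by (metis j le_add1 plus_1_eq_Suc)
    also have "\<dots> < 1 * norm (G (u j))"
      using M that(2) by (intro mult_strict_right_mono) auto
    finally show ?thesis
      by (simp add: j add.commute)
  qed
  then show thesis by (rule that)
qed

end

section \<open>Convergence of the discrete iterates at a fixed index\<close>

locale consistent_discretization =
  fixes V :: "real \<Rightarrow> 'b::real_vector set"
    and ip :: "real \<Rightarrow> 'b \<Rightarrow> 'b \<Rightarrow> real"
    and Gh :: "real \<Rightarrow> 'b \<Rightarrow> 'b"
    and Ph :: "real \<Rightarrow> 'b \<Rightarrow> 'a::real_inner"
    and G :: "'a \<Rightarrow> 'a"
    and N :: "'a set"
  assumes subspace: "\<And>h. 0 < h \<Longrightarrow> subspace (V h)"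
    and Gh_in: "\<And>h x. 0 < h \<Longrightarrow> x \<in> V h \<Longrightarrow> Gh h x \<in> V h"
    and Ph_linear: "\<And>h. 0 < h \<Longrightarrow> linear_map_on (V h) (Ph h)"
    and ip_tendsto: "\<And>x z x\<^sub>0 z\<^sub>0. discrete_family V x \<Longrightarrow> discrete_family V z \<Longrightarrow>
               H_converges Ph x x\<^sub>0 \<Longrightarrow> H_converges Ph z z\<^sub>0 \<Longrightarrow>
               ((\<lambda>h. ip h (x h) (z h)) \<longlongrightarrow> x\<^sub>0 \<bullet> z\<^sub>0) (at_right 0)"
    and Gh_converges: "\<And>x x\<^sub>0. discrete_family V x \<Longrightarrow> x\<^sub>0 \<in> N \<Longrightarrow> H_converges Ph x x\<^sub>0 \<Longrightarrow>
               H_converges Ph (\<lambda>h. Gh h (x h)) (G x\<^sub>0)"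
begin

lemma H_converges_iff: "H_converges Ph x x\<^sub>0 \<longleftrightarrow> ((\<lambda>h. Ph h (x h)) \<longlongrightarrow> x\<^sub>0) (at_right 0)"
  unfolding H_converges_def by (simp add: tendsto_norm_zero_iff LIM_zero_iff)

lemma discrete_family_Gh:
  "discrete_family V x \<Longrightarrow> discrete_family V (\<lambda>h. Gh h (x h))"
  by (simp add: discrete_family_def Gh_in)

lemma discrete_family_diff:
  "discrete_family V x \<Longrightarrow> discrete_family V z \<Longrightarrow> discrete_family V (\<lambda>h. x h - z h)"
  by (simp add: discrete_family_def subspace subspace_diff)

lemma discrete_family_scaleR:
  "discrete_family V x \<Longrightarrow> discrete_family V (\<lambda>h. c h *\<^sub>R x h)"
  by (simp add: discrete_family_def subspace subspace_scale)

lemma H_converges_scaleR: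
  assumes "discrete_family V x" "H_converges Ph x x\<^sub>0" "(c \<longlongrightarrow> c\<^sub>0) (at_right 0)"
  shows "H_converges Ph (\<lambda>h. c h *\<^sub>R x h) (c\<^sub>0 *\<^sub>R x\<^sub>0)"
proof -
  have "Ph h (c h *\<^sub>R x h) = c h *\<^sub>R Ph h (x h)" if "0 < h" for h
    using Ph_linear[OF that] assms(1) that by (simp add: linear_map_on_def discrete_family_def)
  then have "\<forall>\<^sub>F h in at_right 0. c h *\<^sub>R Ph h (x h) = Ph h (c h *\<^sub>R x h)"
    using eventually_at_right_less[of "0::real"] by (auto elim!: eventually_mono)
  then show ?thesis
    using tendsto_scaleR[OF assms(3) assms(2)[unfolded H_converges_iff]] Lim_transform_eventually
    unfolding H_converges_iff by fast
qed

lemma H_converges_diff: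
  assumes "discrete_family V x" "discrete_family V z" "H_converges Ph x x\<^sub>0" "H_converges Ph z z\<^sub>0"
  shows "H_converges Ph (\<lambda>h. x h - z h) (x\<^sub>0 - z\<^sub>0)"
proof -
  have "Ph h (x h - z h) = Ph h (x h) - Ph h (z h)" if "0 < h" for h
  proof -
    have "x h \<in> V h" "z h \<in> V h" "(-1) *\<^sub>R z h \<in> V h"
      using assms(1,2) subspace[OF that] that
      by (auto simp: discrete_family_def subspace_neg)
    then have "Ph h (x h + (-1) *\<^sub>R z h) = Ph h (x h) + (-1) *\<^sub>R Ph h (z h)"
      using Ph_linear[OF that] unfolding linear_map_on_def by metis
    then show ?thesis by simp
  qed
  then have "\<forall>\<^sub>F h in at_right 0. Ph h (x h) - Ph h (z h) = Ph h (x h - z h)"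
    using eventually_at_right_less[of "0::real"] by (auto elim!: eventually_mono)
  then show ?thesis
    using tendsto_diff[OF assms(3,4)[unfolded H_converges_iff]] Lim_transform_eventually
    unfolding H_converges_iff by fast
qed

lemma residual_tendsto:
  assumes "discrete_family V x" "x\<^sub>0 \<in> N" "H_converges Ph x x\<^sub>0"
  shows "((\<lambda>h. ip_norm (ip h) (Gh h (x h))) \<longlongrightarrow> norm (G x\<^sub>0)) (at_right 0)"
  unfolding ip_norm_def norm_eq_sqrt_inner
  by (intro tendsto_real_sqrt ip_tendsto Gh_converges discrete_family_Gh assms)

context
  fixes r :: "nat \<Rightarrow> bb_rule" and u :: "nat \<Rightarrow> 'a" and uh :: "real \<Rightarrow> nat \<Rightarrow> 'b"
  assumes bb: "bb_sequence (\<bullet>) G r u"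
    and bb_h: "\<And>h. 0 < h \<Longrightarrow> bb_sequence (ip h) (Gh h) r (uh h)"
    and init_family: "discrete_family V (\<lambda>h. uh h 0)" "discrete_family V (\<lambda>h. uh h 1)"
    and init_converges: "H_converges Ph (\<lambda>h. uh h 0) (u 0)" "H_converges Ph (\<lambda>h. uh h 1) (u 1)"
    and iterates_in_N: "\<And>k. u k \<in> N"
begin

lemma iterates_family: "discrete_family V (\<lambda>h. uh h k)"
proof (induction k rule: nat_less_induct)
  case (1 k)
  show ?case
  proof (cases "k \<le> 1")
    case True
    then show ?thesis using init_family by (cases k) auto
  next
    case False
    then obtain n where k: "k = Suc n" "1 \<le> n" by (cases k) auto
    then have n: "discrete_family V (\<lambda>h. uh h n)" using 1 by simp
    have "discrete_family V
        (\<lambda>h. uh h n - (1 / bb_alpha (ip h) (Gh h) (r n) (uh h) n) *\<^sub>R Gh h (uh h n))"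
      by (intro discrete_family_diff discrete_family_scaleR discrete_family_Gh n)
    moreover have "uh h (Suc n)
        = uh h n - (1 / bb_alpha (ip h) (Gh h) (r n) (uh h) n) *\<^sub>R Gh h (uh h n)" if "0 < h" for h
      using bb_h[OF that] k(2) unfolding bb_sequence_def by blast
    ultimately show ?thesis
      unfolding discrete_family_def k(1) by simp
  qed
qed

text \<open>A nonzero curvature in the limit makes all denominators nonzero, including that of
  \<open>1 / bb_alpha\<close>.\<close>

lemma step_converges:
  assumes "1 \<le> k" "H_converges Ph (\<lambda>h. uh h (k - 1)) (u (k - 1))" "H_converges Ph (\<lambda>h. uh h k) (u k)"
    and curvature: "(u k - u (k - 1)) \<bullet> (G (u k) - G (u (k - 1))) \<noteq> 0"
  shows "H_converges Ph (\<lambda>h. uh h (Suc k)) (u (Suc k))"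
proof -
  define S where "S h = uh h k - uh h (k - 1)" for h
  define Y where "Y h = Gh h (uh h k) - Gh h (uh h (k - 1))" for h
  define S\<^sub>0 where "S\<^sub>0 = u k - u (k - 1)"
  define Y\<^sub>0 where "Y\<^sub>0 = G (u k) - G (u (k - 1))"
  have fam: "discrete_family V S" "discrete_family V Y"
    unfolding S_def[abs_def] Y_def[abs_def]
    by (intro discrete_family_diff discrete_family_Gh iterates_family)+
  have conv: "H_converges Ph S S\<^sub>0" "H_converges Ph Y Y\<^sub>0"
    unfolding S_def[abs_def] Y_def[abs_def] S\<^sub>0_def Y\<^sub>0_def
    by (intro H_converges_diff discrete_family_Gh iterates_family Gh_converges
        iterates_in_N assms)+
  have nonzero: "S\<^sub>0 \<bullet> Y\<^sub>0 \<noteq> 0" "S\<^sub>0 \<bullet> S\<^sub>0 \<noteq> 0" "Y\<^sub>0 \<bullet> Y\<^sub>0 \<noteq> 0"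
    using curvature by (auto simp: S\<^sub>0_def Y\<^sub>0_def)
  have alpha: "bb_alpha (\<bullet>) G (r k) u k
      = (case r k of BB1 \<Rightarrow> S\<^sub>0 \<bullet> Y\<^sub>0 / (S\<^sub>0 \<bullet> S\<^sub>0) | BB2 \<Rightarrow> Y\<^sub>0 \<bullet> Y\<^sub>0 / (S\<^sub>0 \<bullet> Y\<^sub>0))"
    unfolding bb_alpha_def S\<^sub>0_def Y\<^sub>0_def Let_def ..
  have "((\<lambda>h. bb_alpha (ip h) (Gh h) (r k) (uh h) k) \<longlongrightarrow> bb_alpha (\<bullet>) G (r k) u k) (at_right 0)"
    unfolding alpha unfolding bb_alpha_def Let_def S_def[symmetric] Y_def[symmetric]
    by (cases "r k") (auto intro!: tendsto_divide ip_tendsto fam conv nonzero)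
  moreover have "bb_alpha (\<bullet>) G (r k) u k \<noteq> 0"
    using nonzero unfolding alpha by (cases "r k") auto
  ultimately have "((\<lambda>h. 1 / bb_alpha (ip h) (Gh h) (r k) (uh h) k)
      \<longlongrightarrow> 1 / bb_alpha (\<bullet>) G (r k) u k) (at_right 0)"
    by (intro tendsto_divide tendsto_const)
  then have "H_converges Ph
      (\<lambda>h. uh h k - (1 / bb_alpha (ip h) (Gh h) (r k) (uh h) k) *\<^sub>R Gh h (uh h k))
      (u k - (1 / bb_alpha (\<bullet>) G (r k) u k) *\<^sub>R G (u k))"
    by (intro H_converges_diff H_converges_scaleR discrete_family_scaleR discrete_family_Gh
        iterates_family Gh_converges iterates_in_N assms)
  moreover have "\<forall>\<^sub>F h in at_right 0.
      Ph h (uh h k - (1 / bb_alpha (ip h) (Gh h) (r k) (uh h) k) *\<^sub>R Gh h (uh h k))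
        = Ph h (uh h (Suc k))"
    using eventually_at_right_less[of "0::real"]
  proof (rule eventually_mono)
    fix h :: real assume "0 < h"
    then show "Ph h (uh h k - (1 / bb_alpha (ip h) (Gh h) (r k) (uh h) k) *\<^sub>R Gh h (uh h k))
        = Ph h (uh h (Suc k))"
      using bb_h[of h] \<open>1 \<le> k\<close> unfolding bb_sequence_def by simp
  qed
  moreover have "u (Suc k) = u k - (1 / bb_alpha (\<bullet>) G (r k) u k) *\<^sub>R G (u k)"
    using bb \<open>1 \<le> k\<close> by (simp add: bb_sequence_def)
  ultimately show ?thesis
    unfolding H_converges_iff by (simp only: Lim_transform_eventually)
qed

lemma iterates_converge:
  assumes "\<And>j. 1 \<le> j \<Longrightarrow> j < k \<Longrightarrow> (u j - u (j - 1)) \<bullet> (G (u j) - G (u (j - 1))) \<noteq> 0"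
  shows "H_converges Ph (\<lambda>h. uh h k) (u k)"
  using assms
proof (induction k rule: nat_less_induct)
  case (1 k)
  show ?case
  proof (cases "k \<le> 1")
    case True
    then show ?thesis using init_converges by (cases k) auto
  next
    case False
    then obtain n where k: "k = Suc n" "1 \<le> n" by (cases k) auto
    show ?thesis
      unfolding k(1) using k 1 by (intro step_converges) auto
  qed
qed

end

end

section \<open>Mesh independence of the iteration count\<close>

theorem theorem6:
  fixes F :: "'a::{real_inner, complete_space} \<Rightarrow> real"
    and F' :: "'a \<Rightarrow> ('a \<Rightarrow>\<^sub>L real)"
    and F'' :: "'a \<Rightarrow> ('a \<Rightarrow>\<^sub>L ('a \<Rightarrow>\<^sub>L real))"
    and G :: "'a \<Rightarrow> 'a"
    and ustar :: 'a
    and \<delta>inf \<delta>sup \<zeta> lam1 lam2 \<theta> :: real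
    and D N :: "'a set"
    and r :: "nat \<Rightarrow> bb_rule"
    and u :: "nat \<Rightarrow> 'a"
    and V :: "real \<Rightarrow> 'b::real_vector set"
    and ip :: "real \<Rightarrow> 'b \<Rightarrow> 'b \<Rightarrow> real"
    and Gh :: "real \<Rightarrow> 'b \<Rightarrow> 'b"
    and Ph :: "real \<Rightarrow> 'b \<Rightarrow> 'a"
    and uh :: "real \<Rightarrow> nat \<Rightarrow> 'b"
  \<comment> \<open>continuous problem\<close>
  assumes F_deriv: "\<And>x. (F has_derivative blinfun_apply (F' x)) (at x)"
    and F'_deriv: "\<And>x. (F' has_derivative blinfun_apply (F'' x)) (at x)"
    and F''_cont: "continuous_on UNIV F''"
    and gradient: "\<And>x v. blinfun_apply (F' x) v = G x \<bullet> v"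
  \<comment> \<open>assumption A0\<close>
    and A0_min: "\<forall>\<^sub>F x in nhds ustar. F ustar \<le> F x"
    and A0_lipschitz: "locally_lipschitz F''"
    and A0_delta: "0 < \<delta>inf" "\<delta>inf \<le> \<delta>sup"
    and A0_lower: "\<And>v. \<delta>inf * (norm v)\<^sup>2 \<le> blinfun_apply (blinfun_apply (F'' ustar) v) v"
    and A0_upper: "\<And>v. blinfun_apply (blinfun_apply (F'' ustar) v) v \<le> \<delta>sup * (norm v)\<^sup>2"
  \<comment> \<open>the R-linear convergence constants, and the set of admissible initial iterates\<close>
    and constants: "0 < \<zeta>" "0 < lam1" "0 < lam2" "0 < \<theta>" "\<theta> < 1"
    and admissible: "D = ball ustar \<zeta> \<or> (strictly_convex_quadratic F \<and> D = UNIV)"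
    and r_linear: "bb_r_linear_on G ustar D lam1 lam2 \<theta>"
  \<comment> \<open>the generated sequence\<close>
    and u_init: "u 0 \<in> D" "u 1 \<in> D" "u 1 \<noteq> u 0"
    and u_bb: "bb_sequence (\<bullet>) G r u"
  \<comment> \<open>discrete problems; the step-size rule at iteration \<open>k\<close> is the one of the continuous run\<close>
    and spaces: "\<And>h. 0 < h \<Longrightarrow> finite_dim_hilbert_on (V h) (ip h)"
    and Gh_cont: "\<And>h. 0 < h \<Longrightarrow> continuous_self_map_on (V h) (ip h) (Gh h)"
    and Ph_linear: "\<And>h. 0 < h \<Longrightarrow> linear_map_on (V h) (Ph h)"
    and uh_in: "\<And>h. 0 < h \<Longrightarrow> uh h 0 \<in> V h" "\<And>h. 0 < h \<Longrightarrow> uh h 1 \<in> V h"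
    and uh_bb: "\<And>h. 0 < h \<Longrightarrow> bb_sequence (ip h) (Gh h) r (uh h)"
  \<comment> \<open>assumption A1\<close>
    and A1: "\<And>x z x\<^sub>0 z\<^sub>0. discrete_family V x \<Longrightarrow> discrete_family V z \<Longrightarrow>
               H_converges Ph x x\<^sub>0 \<Longrightarrow> H_converges Ph z z\<^sub>0 \<Longrightarrow>
               ((\<lambda>h. ip h (x h) (z h)) \<longlongrightarrow> x\<^sub>0 \<bullet> z\<^sub>0) (at_right 0)"
  \<comment> \<open>assumption A2, on a neighborhood \<open>N\<close> of \<open>ustar\<close> that contains the iterates\<close>
    and A2_zero: "G ustar = 0"
    and A2_nhd: "open N" "ustar \<in> N"
    and A2: "\<And>x x\<^sub>0. discrete_family V x \<Longrightarrow> x\<^sub>0 \<in> N \<Longrightarrow> H_converges Ph x x\<^sub>0 \<Longrightarrow>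
               H_converges Ph (\<lambda>h. Gh h (x h)) (G x\<^sub>0)"
    and u_in_N: "\<And>k. u k \<in> N"
  \<comment> \<open>initial iterates\<close>
    and init_conv: "H_converges Ph (\<lambda>h. uh h 0) (u 0)" "H_converges Ph (\<lambda>h. uh h 1) (u 1)"
    and init_neq: "\<And>h. 0 < h \<Longrightarrow> uh h 1 \<noteq> uh h 0"
  shows "\<exists>l::int. 0 < l \<and> (\<forall>\<epsilon>>0.
           (\<exists>k\<ge>1. norm (G (u k)) < \<epsilon>) \<and>
           (\<exists>h0>0. \<forall>h\<in>{0<..h0}.
              (\<exists>k\<ge>1. ip_norm (ip h) (Gh h (uh h k)) < \<epsilon>) \<and>
              int (iteration_count (\<lambda>k. norm (G (u k))) \<epsilon>) - l
                \<le> int (iteration_count (\<lambda>k. ip_norm (ip h) (Gh h (uh h k))) \<epsilon>) \<and>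
              iteration_count (\<lambda>k. ip_norm (ip h) (Gh h (uh h k))) \<epsilon>
                \<le> iteration_count (\<lambda>k. norm (G (u k))) \<epsilon>))"
proof -
  let ?g = "\<lambda>k. norm (G (u k))"
  let ?gh = "\<lambda>h k. ip_norm (ip h) (Gh h (uh h k))"
  let ?n = "iteration_count ?g"

  interpret consistent_discretization V ip Gh Ph G N
  proof
    show "subspace (V h)" if "0 < h" for h
      using spaces[OF that] unfolding finite_dim_hilbert_on_def by auto
    show "Gh h x \<in> V h" if "0 < h" "x \<in> V h" for h x
      using Gh_cont[OF that(1)] that(2) unfolding continuous_self_map_on_def by auto
  qed (fact Ph_linear A1 A2)+

  have init_family: "discrete_family V (\<lambda>h. uh h 0)" "discrete_family V (\<lambda>h. uh h 1)"
    using uh_in by (auto simp: discrete_family_def)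
  note family = iterates_family[OF u_bb uh_bb init_family init_conv u_in_N]
  note run = r_linear constants(4,5) u_init u_bb

  have g_lim: "?g \<longlonglongrightarrow> 0"
    by (rule bb_gradient_tendsto[OF run])
  have "open D" "ustar \<in> D"
    using admissible constants(1) by auto
  then have "eventually (\<lambda>k. u k \<in> D) sequentially"
    using topological_tendstoD[OF bb_iterates_tendsto[OF run]] by blast
  then obtain K M where "\<And>j. K \<le> j \<Longrightarrow> G (u j) \<noteq> 0 \<Longrightarrow> ?g (j + M) < ?g j"
    using bb_gradient_decrease[OF run] by blast
  then obtain l where l: "0 < l"
    "\<And>j \<epsilon>. 0 < \<epsilon> \<Longrightarrow> 1 \<le> j \<Longrightarrow> ?g j \<le> \<epsilon> \<Longrightarrow> ?n \<epsilon> \<le> j + l"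
    using iteration_count_after_tie[OF g_lim, of K M] by auto

  show ?thesis
  proof (intro exI[of _ "int l"] conjI allI impI)
    show "0 < int l" using l(1) by simp
  next
    fix \<epsilon> :: real assume \<epsilon>: "0 < \<epsilon>"
    show ex: "\<exists>k\<ge>1. ?g k < \<epsilon>"
      by (rule small_residual_exists[OF g_lim \<epsilon>])
    note n = iteration_count_attained[OF ex]

    have res: "((\<lambda>h. ?gh h k) \<longlongrightarrow> ?g k) (at_right 0)" if "k \<le> ?n \<epsilon>" for k
    proof -
      have "(u j - u (j - 1)) \<bullet> (G (u j) - G (u (j - 1))) \<noteq> 0" if "1 \<le> j" "j < k" for j
        using not_below_before_iteration_count[of j ?g \<epsilon>] that \<open>k \<le> ?n \<epsilon>\<close> \<epsilon>
        by (intro bb_curvature_nonzero[OF run]) auto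
      then show ?thesis
        by (intro residual_tendsto family u_in_N
            iterates_converge[OF u_bb uh_bb init_family init_conv u_in_N])
    qed

    have "\<forall>\<^sub>F h in at_right 0. ?gh h (?n \<epsilon>) < \<epsilon>"
      using order_tendstoD(2)[OF res] n(2) by blast
    moreover have "\<forall>\<^sub>F h in at_right 0. \<forall>j\<in>{j. j < ?n \<epsilon> \<and> \<epsilon> < ?g j}. \<epsilon> < ?gh h j"
      using order_tendstoD(1)[OF res] by (intro eventually_ball_finite) auto
    ultimately have "\<forall>\<^sub>F h in at_right 0. ?gh h (?n \<epsilon>) < \<epsilon> \<and>
        (\<forall>j\<in>{j. j < ?n \<epsilon> \<and> \<epsilon> < ?g j}. \<epsilon> < ?gh h j)"
      by (rule eventually_conj)
    then obtain b where b: "0 < b" "\<And>h. 0 < h \<Longrightarrow> h < b \<Longrightarrow> ?gh h (?n \<epsilon>) < \<epsilon>"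
      "\<And>h j. 0 < h \<Longrightarrow> h < b \<Longrightarrow> j < ?n \<epsilon> \<Longrightarrow> \<epsilon> < ?g j \<Longrightarrow> \<epsilon> < ?gh h j"
      unfolding eventually_at_right_field by auto

    show "\<exists>h0>0. \<forall>h\<in>{0<..h0}.
        (\<exists>k\<ge>1. ?gh h k < \<epsilon>) \<and>
        int (?n \<epsilon>) - int l \<le> int (iteration_count (?gh h) \<epsilon>) \<and>
        iteration_count (?gh h) \<epsilon> \<le> ?n \<epsilon>"
    proof (intro exI[of _ "b / 2"] conjI ballI)
      show "0 < b / 2" using b(1) by simp
    next
      fix h assume "h \<in> {0<..b / 2}"
      then have h: "0 < h" "h < b" using b(1) by auto
      show ex_h: "\<exists>k\<ge>1. ?gh h k < \<epsilon>"
        using b(2)[OF h] n(1) by blast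
      show le: "iteration_count (?gh h) \<epsilon> \<le> ?n \<epsilon>"
        using iteration_count_le[of "?n \<epsilon>" "?gh h" \<epsilon>] b(2)[OF h] n(1) by blast
      \<comment> \<open>the continuous residual cannot exceed \<open>\<epsilon>\<close> where the discrete run stops: it is a tie or
         smaller\<close>
      let ?m = "iteration_count (?gh h) \<epsilon>"
      note m = iteration_count_attained[OF ex_h]
      have "?g ?m \<le> \<epsilon>"
        using le n(2) m(2) b(3)[OF h, of ?m] by (cases "?m = ?n \<epsilon>") force+
      then have "?n \<epsilon> \<le> ?m + l"
        using l(2)[OF \<epsilon>] m(1) by blast
      then show "int (?n \<epsilon>) - int l \<le> int ?m"
        by simp
    qed
  qed
qed

end
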